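(* Let $k\ge 0$ be an integer. For any graph $G$, \[\gamma_P(G)+k\leq \ddot{\gamma}_P^k(G)\leq (k+1)\gamma_P(G).\]
   Context: All graphs are finite, simple, undirected, with nonempty vertex set. For $S\subseteq V(G)$ the power domination process is: (1) start with the observed set $N[S]$ (the union of closed neighborhoods of vertices of $S$); (2) while some observed vertex has exactly one unobserved neighbor $w$, add $w$ to the observed set. $S$ is a power dominating set if eventually all vertices are observed. $\gamma_P(G)$ is the minimum cardinality of a power dominating set. For an integer $k\ge 0$, a multiset $S$ of vertices of $G$ is a $k$-PMU-defect-robust power dominating set ($k$-rPDS) if $|S|\ge k$ and for every submultiset $F$ of $S$ with $|F|=k$, the underlying set of $S\setminus F$ (multiset difference) contains a power dominating set of $G$. Cardinalities of multisets count multiplicity. $\ddot{\gamma}_P^k(G)$ is the minimum cardinality of a $k$-rPDS of $G$. *)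

theory Defs
  imports "Graph_Theory.Digraph" "HOL-Library.Multiset"
begin

(* A finite simple undirected graph is expressed by the library predicate "graph G": a finite digraph without
   loops and parallel arcs in which every edge is present as a pair of opposite arcs. *)

definition nbhd :: "('a, 'b) pre_digraph \<Rightarrow> 'a \<Rightarrow> 'a set" where
  "nbhd G v = {u. v \<rightarrow>\<^bsub>G\<^esub> u}"

definition closed_nbhd_set :: "('a, 'b) pre_digraph \<Rightarrow> 'a set \<Rightarrow> 'a set" where
  "closed_nbhd_set G S = (\<Union>v\<in>S. insert v (nbhd G v))"

inductive observation_step :: "('a, 'b) pre_digraph \<Rightarrow> 'a set \<Rightarrow> 'a set \<Rightarrow> bool"
  for G :: "('a, 'b) pre_digraph" where
  "\<lbrakk>v \<in> X; nbhd G v - X = {w}\<rbrakk> \<Longrightarrow> observation_step G X (insert w X)"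

(* The order of the steps is irrelevant: a vertex that can be added now either has been added or
   can still be added later. So some run observes everything iff every maximal run does. *)
definition power_dominating_set :: "('a, 'b) pre_digraph \<Rightarrow> 'a set \<Rightarrow> bool" where
  "power_dominating_set G S \<longleftrightarrow>
     S \<subseteq> verts G \<and> (observation_step G)\<^sup>*\<^sup>* (closed_nbhd_set G S) (verts G)"

(* Both minima below are attained for every nonempty finite graph: the vertex set is power
   dominating, and k + 1 copies of it form a k-robust power dominating multiset. *)
definition power_domination_number :: "('a, 'b) pre_digraph \<Rightarrow> nat" where
  "power_domination_number G = (LEAST n. \<exists>S. power_dominating_set G S \<and> card S = n)"

definition robust_power_dominating_mset ::
    "nat \<Rightarrow> ('a, 'b) pre_digraph \<Rightarrow> 'a multiset \<Rightarrow> bool" where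
  "robust_power_dominating_mset k G S \<longleftrightarrow>
     set_mset S \<subseteq> verts G \<and> k \<le> size S \<and>
     (\<forall>F. F \<subseteq># S \<and> size F = k \<longrightarrow>
        (\<exists>T. T \<subseteq> set_mset (S - F) \<and> power_dominating_set G T))"

definition robust_power_domination_number :: "nat \<Rightarrow> ('a, 'b) pre_digraph \<Rightarrow> nat" where
  "robust_power_domination_number k G =
     (LEAST n. \<exists>S. robust_power_dominating_mset k G S \<and> size S = n)"

end

theory Submission
  imports Defs
begin

text \<open>Lower bound: deleting any k elements from a k-robust multiset M leaves a multiset of
  size |M| - k whose underlying set contains a power dominating set, so |M| - k is at least the
  power domination number (\<open>size_robust_power_dominating_mset_ge\<close>). Upper bound: k + 1
  copies of a minimum power dominating set are k-robust, because k deletions cannot exhaust the k +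
  1 copies of any vertex (\<open>robust_power_dominating_mset_copies\<close>). Both numbers are
  defined by \<open>LEAST\<close>, so witnesses are also needed to know that the minima are
  attained.\<close>

lemma power_dominating_set_verts:
  assumes "wf_digraph G"
  shows "power_dominating_set G (verts G)"
proof -
  have "nbhd G v \<subseteq> verts G" for v
    using wf_digraph.adj_in_verts(2)[OF assms] by (auto simp: nbhd_def)
  then have "closed_nbhd_set G (verts G) = verts G"
    unfolding closed_nbhd_set_def by blast
  then show ?thesis
    by (simp add: power_dominating_set_def)
qed

text \<open>Every step is triggered by an already observed vertex, so nothing can start from the
  empty set.\<close>

lemma observation_steps_from_empty:
  assumes "(observation_step G)\<^sup>*\<^sup>* {} X"
  shows "X = {}"
  using assms by (induction rule: rtranclp_induct) (auto elim: observation_step.cases)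

lemma power_dominating_set_nonempty:
  assumes "power_dominating_set G S" "verts G \<noteq> {}"
  shows "S \<noteq> {}"
  using assms observation_steps_from_empty[of G "verts G"]
  by (auto simp: power_dominating_set_def closed_nbhd_set_def)

lemma power_domination_number_le:
  assumes "power_dominating_set G S"
  shows "power_domination_number G \<le> card S"
  unfolding power_domination_number_def using assms by (blast intro: Least_le)

lemma power_domination_number_attained:
  assumes "wf_digraph G"
  obtains S where "power_dominating_set G S" "card S = power_domination_number G"
proof -
  have "\<exists>n S. power_dominating_set G S \<and> card S = n"
    using power_dominating_set_verts[OF assms] by blast
  from LeastI_ex[OF this] show ?thesis
    using that unfolding power_domination_number_def by blast
qed

lemma robust_power_domination_number_le:
  assumes "robust_power_dominating_mset k G M"
  shows "robust_power_domination_number k G \<le> size M"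
  unfolding robust_power_domination_number_def using assms by (blast intro: Least_le)

text \<open>\<open>LEAST\<close> says nothing about an unsatisfiable predicate, so some robust
  multiset must be supplied; the copies of a power dominating set will serve.\<close>

lemma robust_power_domination_number_attained:
  assumes "robust_power_dominating_mset k G M"
  obtains N where "robust_power_dominating_mset k G N"
    "size N = robust_power_domination_number k G"
proof -
  have "\<exists>n N. robust_power_dominating_mset k G N \<and> size N = n"
    using assms by blast
  from LeastI_ex[OF this] show ?thesis
    using that unfolding robust_power_domination_number_def by blast
qed

lemma robust_power_dominating_mset_copies:
  assumes S: "power_dominating_set G S" and "finite S" "S \<noteq> {}"
  shows "robust_power_dominating_mset k G (repeat_mset (k + 1) (mset_set S))"
    (is "robust_power_dominating_mset k G ?M")
proof -
  have "S \<subseteq> set_mset (?M - F)" if "size F = k" for F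
  proof
    fix v assume "v \<in> S"
    \<comment> \<open>The multiplicity of v in F is at most the size k of F, while \<open>?M\<close>
      holds k + 1 copies of v.\<close>
    then have "count F v < count ?M v"
      using \<open>finite S\<close> count_le_size[of F v] that by simp
    then show "v \<in> set_mset (?M - F)"
      by (simp add: in_diff_count)
  qed
  moreover have "k \<le> size ?M"
  proof -
    \<comment> \<open>If S were empty, so would be \<open>?M\<close>, and the size condition would
      fail for positive k.\<close>
    have "0 < card S"
      using assms by (simp add: card_gt_0_iff)
    then have "(k + 1) * 1 \<le> (k + 1) * card S"
      by (intro mult_le_mono2) simp
    then show ?thesis by simp
  qed
  moreover have "set_mset ?M \<subseteq> verts G"
    using S
    by (auto simp: power_dominating_set_def count_mset_set' simp flip: count_greater_zero_iff
        split: if_splits)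
  ultimately show ?thesis
    using S unfolding robust_power_dominating_mset_def by blast
qed

lemma obtain_submset_of_size:
  assumes "k \<le> size M"
  obtains F where "F \<subseteq># M" "size F = k"
proof -
  \<comment> \<open>With M listed in some order, the first k entries form F.\<close>
  obtain xs where xs: "mset xs = M"
    using ex_mset by blast
  have "mset (take k xs) \<subseteq># mset xs"
    by (metis append_take_drop_id mset_append mset_subset_eq_add_left)
  then show ?thesis
    using that[of "mset (take k xs)"] xs assms by auto
qed

lemma size_robust_power_dominating_mset_ge:
  assumes "robust_power_dominating_mset k G M"
  shows "power_domination_number G + k \<le> size M"
proof -
  have "k \<le> size M"
    using assms by (simp add: robust_power_dominating_mset_def)
  then obtain F where F: "F \<subseteq># M" "size F = k"
    by (rule obtain_submset_of_size)
  then obtain T where T: "T \<subseteq> set_mset (M - F)" "power_dominating_set G T"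
    using assms unfolding robust_power_dominating_mset_def by blast
  have "power_domination_number G \<le> card T"
    by (rule power_domination_number_le) (fact T)
  also have "\<dots> \<le> card (set_mset (M - F))"
    using T by (simp add: card_mono)
  \<comment> \<open>Passing to the underlying set only forgets multiplicities.\<close>
  also have "\<dots> \<le> size (M - F)"
    by (metis mset_set_set_mset_msubset size_mset_mono size_mset_set)
  also have "\<dots> = size M - k"
    using F by (simp add: size_Diff_submset)
  finally show ?thesis
    using \<open>k \<le> size M\<close> by simp
qed

theorem proposition2:
  fixes G :: "('a, 'b) pre_digraph" and k :: nat
  assumes "graph G" and "verts G \<noteq> {}"
  shows "power_domination_number G + k \<le> robust_power_domination_number k G
    \<and> robust_power_domination_number k G \<le> (k + 1) * power_domination_number G"
proof -
  interpret graph G by fact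
  obtain S where S: "power_dominating_set G S" "card S = power_domination_number G"
    by (rule power_domination_number_attained[OF wf_digraph_axioms])
  have "finite S"
    using S(1) finite_verts finite_subset unfolding power_dominating_set_def by blast
  then have M: "robust_power_dominating_mset k G (repeat_mset (k + 1) (mset_set S))"
    using S(1) power_dominating_set_nonempty[OF S(1) assms(2)]
    by (intro robust_power_dominating_mset_copies)
  \<comment> \<open>The copies of S play two roles: they show that a minimum N exists, to which the
    lower bound applies, and their size is the upper bound.\<close>
  obtain N where N: "robust_power_dominating_mset k G N"
      "size N = robust_power_domination_number k G"
    by (rule robust_power_domination_number_attained[OF M])
  show ?thesis
    using size_robust_power_dominating_mset_ge[OF N(1)] N(2)
      robust_power_domination_number_le[OF M] S(2) by simp
qed

end
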